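(* Let $\varphi = \frac{1+\sqrt5}{2}$. For every $\varepsilon > 0$ there are infinitely many integer-valued polynomials $P$ that satisfy $$|P(n)| \le \left(\sqrt{2\varphi} + \varepsilon\right)\varphi^n \quad \text{for all } n \in \mathbb{N} = \{0,1,2,\dots\}.$$
   Context: An integer-valued polynomial is a polynomial $P$ (of arbitrary degree) that takes integer values on $\mathbb{N} = \{0,1,2,\dots\}$ (equivalently, on $\mathbb{Z}$). *)

theory Defs
  imports Complex_Main "HOL-Computational_Algebra.Polynomial"
begin

(* Real coefficients lose nothing: a polynomial that is integer-valued on the
   naturals has rational coefficients, by Lagrange interpolation. *)
definition integer_valued :: "real poly \<Rightarrow> bool" where
  "integer_valued P \<longleftrightarrow> (\<forall>n::nat. poly P (real n) \<in> \<int>)"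

definition golden_ratio :: real where
  "golden_ratio = (1 + sqrt 5) / 2"

end

theory Submission
  imports Defs "HOL-Probability.Probability"
begin

text \<open>
Write \<open>\<phi>\<close> for the golden ratio. The integer-valued polynomials of degree below \<open>N\<close> form the
lattice of integer combinations of the binomial polynomials, and the theorem concerns the points of
this lattice in the symmetric convex body cut out by \<open>\<bar>P n\<bar> \<le> t \<phi>\<^sup>n\<close>, that is, in a section of a
cube by an \<open>N\<close>-dimensional subspace. Two facts make the constant work.

The weight \<open>\<phi>\<^sup>-\<^sup>2\<^sup>n\<close> is critical. Its orthogonal polynomials are Meixner polynomials, and when they are
normalized to be monic in the binomial basis, all of them have the same squared norm \<open>\<phi>\<close>. So the
lattice has covolume \<open>\<phi>\<close> to the power \<open>N/2\<close>. Divided by \<open>\<surd>\<phi> \<phi>\<^sup>n\<close>, their values form a matrix that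
is symmetric up to signs, so that a bound for its row norms is one for its column norms as well
(\<open>meixner_row_sum\<close>, \<open>meixner_column_sum\<close>). The row norms come from the generating functions:
consecutive ones differ by a factor of modulus 1 on the circle of radius \<open>1/\<phi>\<close>.

Many lattice points share a cell. Round every value, measured in units of \<open>\<kappa> \<surd>\<phi> \<phi>\<^sup>n\<close>, to the nearest
integer; this cuts space into cells, and two lattice points in one cell differ by a polynomial that
satisfies the desired bound with \<open>t = \<kappa> \<surd>\<phi>\<close>. Give the cells weights \<open>Q\<close>, products over \<open>n\<close> of
probability distributions on the integers, so that the weights of all cells add up to 1. If each cell
holds at most \<open>C\<close> points of every translate of the lattice, then the sum of \<open>Q\<close> over every translate is
at most \<open>C\<close>, and averaging over translates (\<open>blichfeldt\<close>) gives \<open>\<integral> Q \<le> C\<close>. For a lower bound on this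
integral, compare with a Gaussian density \<open>\<gamma>\<close> in the Meixner coordinates: Jensen's inequality yields
\<open>\<integral> Q \<ge> exp (E (ln Q) - E (ln \<gamma>))\<close>. The second term is an entropy proportional to \<open>N\<close>. The first is a
sum over \<open>n\<close> of one-dimensional expectations, since each value is itself Gaussian, with a variance
proportional to the squared column norm \<open>\<sigma>\<^sub>n\<^sup>2 \<le> 1\<close>. The values are concentrated in the
cell of 0, and with suitable weights each coordinate costs at most \<open>\<sigma>\<^sub>n\<^sup>2/3\<close> (\<open>cell_cost\<close>); the
\<open>\<sigma>\<^sub>n\<^sup>2\<close> add up to at most \<open>N\<close>. Altogether \<open>\<integral> Q \<ge> (\<kappa>/\<surd>2)\<^sup>N\<close> (\<open>meixner_cell_count\<close>).

For \<open>\<kappa> > \<surd>2\<close> this is unbounded in \<open>N\<close>, whereas a finite number \<open>C\<close> of admissible polynomials would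
bound the number of lattice points in every cell by \<open>C\<close>. Only finitely many \<open>n\<close> need to be
considered for a given \<open>N\<close>, because polynomials grow more slowly than \<open>\<phi>\<^sup>n\<close>
(\<open>binomial_sum_bound_extends\<close>).
\<close>

section \<open>Meixner polynomials at the golden ratio\<close>

lemma golden_ratio_gt_1: "golden_ratio > 1"
  unfolding golden_ratio_def using real_less_rsqrt[of 1 5] by simp

lemma golden_ratio_sq: "golden_ratio\<^sup>2 = golden_ratio + 1"
  unfolding golden_ratio_def by (simp add: power2_eq_square field_simps)

text \<open>This is the hypergeometric polynomial \<open>\<^sub>2F\<^sub>1(-k, -n; 1; -\<phi>)\<close>, the Meixner polynomial \<open>M\<^sub>k(n; 1, \<phi>\<^sup>-\<^sup>2)\<close>, written
in a form that shows its symmetry in \<open>k\<close> and \<open>n\<close>.\<close>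

definition binom_kernel :: "nat \<Rightarrow> nat \<Rightarrow> real" where
  "binom_kernel k n = (\<Sum>j\<le>k. real (k choose j) * real (n choose j) * (- golden_ratio) ^ j)"

lemma binom_kernel_extend:
  assumes "k \<le> K"
  shows "binom_kernel k n = (\<Sum>j\<le>K. real (k choose j) * real (n choose j) * (- golden_ratio) ^ j)"
  unfolding binom_kernel_def using assms
  by (intro sum.mono_neutral_left) (auto simp: not_le)

lemma binom_kernel_sym: "binom_kernel k n = binom_kernel n k"
  using binom_kernel_extend[of k "max k n" n] binom_kernel_extend[of n "max k n" k]
  by (simp add: mult_ac)

lemma binom_kernel_0 [simp]: "binom_kernel 0 n = 1" "binom_kernel k 0 = 1"
proof -
  show *: "binom_kernel 0 n = 1" for n by (simp add: binom_kernel_def)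
  show "binom_kernel k 0 = 1" using *[of k] by (simp add: binom_kernel_sym[of k 0])
qed

text \<open>The mixed second difference of \<open>C(k,j) C(n,j)\<close> is \<open>C(k,j-1) C(n,j-1)\<close> by Pascal's rule, so the mixed
difference of the kernel is \<open>-\<phi>\<close> times the kernel. The golden ratio enters through
\<open>1 + \<phi> = \<phi>\<^sup>2\<close>.\<close>

lemma binom_kernel_recurrence:
  "binom_kernel (Suc k) (Suc n) - binom_kernel (Suc k) n =
   binom_kernel k (Suc n) - golden_ratio\<^sup>2 * binom_kernel k n"
proof -
  let ?c = "\<lambda>a b j. real (a choose j) * real (b choose j) * (- golden_ratio) ^ j"
  have "binom_kernel (Suc k) (Suc n) - binom_kernel (Suc k) n - binom_kernel k (Suc n) + binom_kernel k n
     = (\<Sum>j\<le>Suc k. ?c (Suc k) (Suc n) j - ?c (Suc k) n j - ?c k (Suc n) j + ?c k n j)"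
    using binom_kernel_extend[of "Suc k" "Suc k" "Suc n"] binom_kernel_extend[of "Suc k" "Suc k" n]
      binom_kernel_extend[of k "Suc k" "Suc n"] binom_kernel_extend[of k "Suc k" n]
    by (simp only: sum.distrib sum_subtractf le_Suc_eq) simp
  also have "\<dots> = (\<Sum>j\<le>k. - golden_ratio * ?c k n j)"
    by (subst sum.atMost_Suc_shift) (auto simp: algebra_simps intro!: sum.cong)
  also have "\<dots> = - golden_ratio * binom_kernel k n"
    by (simp add: binom_kernel_def sum_distrib_left)
  finally show ?thesis by (simp add: golden_ratio_sq algebra_simps)
qed

text \<open>The hypothesis says \<open>(r - x) A(x) = (1 - r x) B(x)\<close> for the generating functions of \<open>a\<close> and \<open>b\<close>, and
\<open>(1 - r x) / (r - x)\<close> has modulus 1 on the unit circle. In terms of partial sums, the energy that is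
missing from \<open>a\<close> up to time \<open>m\<close> is a square, namely \<open>(r b\<^sub>m - a\<^sub>m)\<^sup>2 / (r\<^sup>2 - 1)\<close>.\<close>

lemma all_pass_energy:
  fixes a b :: "nat \<Rightarrow> real"
  assumes "r > 1" and "r * a 0 = b 0" and "\<And>n. r * a (Suc n) - a n = b (Suc n) - r * b n"
  shows "(\<Sum>n<M. (a n)\<^sup>2) \<le> (\<Sum>n<M. (b n)\<^sup>2)"
proof (cases M)
  case (Suc m)
  \<comment> \<open>The telescoping identity: the step reduces to \<open>(x - r y)\<^sup>2 + (r\<^sup>2 - 1) (x\<^sup>2 - y\<^sup>2) = (r x - y)\<^sup>2\<close>.\<close>
  have "(r\<^sup>2 - 1) * (\<Sum>n<Suc m. (b n)\<^sup>2 - (a n)\<^sup>2) = (r * b m - a m)\<^sup>2"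
  proof (induction m)
    case 0
    show ?case by (simp add: assms(2)[symmetric]) (simp add: power2_eq_square algebra_simps)
  next
    case (Suc m)
    have "r * b m - a m = b (Suc m) - r * a (Suc m)" using assms(3)[of m] by simp
    with Suc show ?case by (simp add: algebra_simps power2_eq_square)
  qed
  then have "0 \<le> (r\<^sup>2 - 1) * (\<Sum>n<Suc m. (b n)\<^sup>2 - (a n)\<^sup>2)" by simp
  moreover have "r\<^sup>2 - 1 > 0" using assms(1) by simp
  ultimately show ?thesis by (simp add: Suc zero_le_mult_iff sum_subtractf del: sum.lessThan_Suc)
qed simp

lemma binom_kernel_energy:
  "(\<Sum>n<M. (binom_kernel k n / golden_ratio ^ (k + n))\<^sup>2) \<le> golden_ratio"
proof (induction k)
  case 0
  let ?q = "1 / golden_ratio\<^sup>2"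
  have q: "?q < 1" "0 < ?q" using golden_ratio_gt_1 by (auto simp: field_simps power2_eq_square less_1_mult)
  have "(\<Sum>n<M. (binom_kernel 0 n / golden_ratio ^ (0 + n))\<^sup>2) = (\<Sum>n<M. ?q ^ n)"
    by (intro sum.cong) (auto simp: power_divide power_mult[symmetric] mult.commute)
  also have "\<dots> \<le> (\<Sum>n. ?q ^ n)"
    by (rule sum_le_suminf) (use q in \<open>auto intro!: summable_geometric\<close>)
  also have "\<dots> = 1 / (1 - ?q)"
    by (rule suminf_geometric) (use q in simp)
  also have "\<dots> = golden_ratio\<^sup>2 / (golden_ratio\<^sup>2 - 1)"
    using golden_ratio_gt_1 by (simp add: divide_simps)
  also have "\<dots> = golden_ratio"
    using golden_ratio_gt_1 by (simp add: golden_ratio_sq) (simp add: golden_ratio_sq[symmetric] power2_eq_square)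
  finally show ?case .
next
  case (Suc k)
  have g: "golden_ratio > 0" using golden_ratio_gt_1 by simp
  have "(\<Sum>n<M. (binom_kernel (Suc k) n / golden_ratio ^ (Suc k + n))\<^sup>2)
      \<le> (\<Sum>n<M. (binom_kernel k n / golden_ratio ^ (k + n))\<^sup>2)"
  proof (rule all_pass_energy[OF golden_ratio_gt_1])
    fix n
    have "golden_ratio * (binom_kernel (Suc k) (Suc n) / golden_ratio ^ (Suc k + Suc n))
        - binom_kernel (Suc k) n / golden_ratio ^ (Suc k + n)
      = (binom_kernel (Suc k) (Suc n) - binom_kernel (Suc k) n) / golden_ratio ^ (Suc k + n)"
      using g by (simp add: field_simps)
    also have "\<dots> = (binom_kernel k (Suc n) - golden_ratio\<^sup>2 * binom_kernel k n) / golden_ratio ^ (Suc k + n)"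
      by (simp only: binom_kernel_recurrence)
    also have "\<dots> = binom_kernel k (Suc n) / golden_ratio ^ (k + Suc n)
        - golden_ratio * (binom_kernel k n / golden_ratio ^ (k + n))"
      using g by (simp add: field_simps power2_eq_square)
    finally show "golden_ratio * (binom_kernel (Suc k) (Suc n) / golden_ratio ^ (Suc k + Suc n))
        - binom_kernel (Suc k) n / golden_ratio ^ (Suc k + n) = \<dots>" .
  qed (use g in simp)
  with Suc show ?case by linarith
qed

text \<open>The scaling makes the leading coefficient in the binomial basis the same as that of
\<open>binom_profile\<close> below; it also turns the energy bound \<open>\<phi>\<close> of \<open>binom_kernel_energy\<close> into 1.\<close>

definition meixner :: "nat \<Rightarrow> nat \<Rightarrow> real" where
  "meixner k n = (-1 / golden_ratio) ^ k * binom_kernel k n / (sqrt golden_ratio * golden_ratio ^ n)"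

lemma meixner_sq: "(meixner k n)\<^sup>2 = (binom_kernel k n / golden_ratio ^ (k + n))\<^sup>2 / golden_ratio"
proof -
  have g: "golden_ratio > 0" using golden_ratio_gt_1 by simp
  have "((-1 / golden_ratio) ^ k)\<^sup>2 = (1 / golden_ratio ^ k)\<^sup>2"
    by (simp add: power2_eq_square power_mult_distrib[symmetric] power_divide)
  then show ?thesis using g
    by (simp add: meixner_def power_mult_distrib power_divide power_add)
qed

lemma meixner_sym_sq: "(meixner k n)\<^sup>2 = (meixner n k)\<^sup>2"
  by (simp add: meixner_sq binom_kernel_sym[of k n] add.commute)

lemma meixner_row_sum: "(\<Sum>n<M. (meixner k n)\<^sup>2) \<le> 1"
  using binom_kernel_energy[where M=M and k=k] golden_ratio_gt_1
  by (simp add: meixner_sq sum_divide_distrib[symmetric])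

lemma meixner_column_sum: "(\<Sum>k<N. (meixner k n)\<^sup>2) \<le> 1"
  using meixner_row_sum[where M=N and k=n] by (simp add: meixner_sym_sq[of n])

lemma meixner_0: "meixner 0 n \<noteq> 0"
  using golden_ratio_gt_1 by (simp add: meixner_def)

definition binom_profile :: "nat \<Rightarrow> nat \<Rightarrow> real" where
  "binom_profile k n = real (n choose k) / (sqrt golden_ratio * golden_ratio ^ n)"

text \<open>The change of basis between the two systems has determinant 1, so integrals over the coefficients in
either basis agree. The diagonal entry is \<open>(-1/\<phi>)\<^sup>k (-\<phi>)\<^sup>k = 1\<close>.\<close>

lemma meixner_unitriangular:
  "\<exists>c. \<forall>n. meixner k n = binom_profile k n + (\<Sum>j<k. c j * binom_profile j n)"
proof -
  have g: "golden_ratio > 0" using golden_ratio_gt_1 by simp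
  have "(-1 / golden_ratio) ^ k * (- golden_ratio) ^ k = 1"
    using g by (simp add: power_mult_distrib[symmetric])
  then have "meixner k n = binom_profile k n
      + (\<Sum>j<k. ((-1 / golden_ratio) ^ k * real (k choose j) * (- golden_ratio) ^ j) * binom_profile j n)" for n
    unfolding meixner_def binom_kernel_def binom_profile_def lessThan_Suc_atMost[symmetric] sum.lessThan_Suc
    by (simp add: sum_distrib_left sum_divide_distrib distrib_left add_divide_distrib mult_ac)
  then show ?thesis by (intro exI[of _ "\<lambda>j. (-1 / golden_ratio) ^ k * real (k choose j) * (- golden_ratio) ^ j"]) blast
qed

section \<open>Flat integrals and Blichfeldt's averaging argument\<close>

abbreviation sequences :: "(nat \<Rightarrow> real) measure" where
  "sequences \<equiv> (\<Pi>\<^sub>M n\<in>UNIV. borel)"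

text \<open>The integral of \<open>Q\<close> over the affine space through \<open>v\<close> that is spanned by the first \<open>i\<close> rows of \<open>B\<close>, taken
with respect to the coefficients. As an iterated integral it allows induction on the dimension, both
for the comparison of bases and for Jensen's inequality.\<close>

primrec flat_integral ::
  "(nat \<Rightarrow> nat \<Rightarrow> real) \<Rightarrow> ((nat \<Rightarrow> real) \<Rightarrow> ennreal) \<Rightarrow> nat \<Rightarrow> (nat \<Rightarrow> real) \<Rightarrow> ennreal" where
  "flat_integral B Q 0 v = Q v"
| "flat_integral B Q (Suc i) v = (\<integral>\<^sup>+y. flat_integral B Q i (\<lambda>n. v n + y * B i n) \<partial>lborel)"

lemma measurable_flat_integral [measurable]:
  assumes "Q \<in> borel_measurable sequences"
  shows "flat_integral B Q i \<in> borel_measurable sequences"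
proof (induction i)
  case 0
  show ?case using assms by (simp cong: measurable_cong)
next
  case (Suc i)
  have "(\<lambda>p. flat_integral B Q i (\<lambda>n. fst p n + snd p * B i n)) \<in> borel_measurable (sequences \<Otimes>\<^sub>M lborel)"
    by (rule measurable_compose[OF _ Suc], rule measurable_abs_UNIV) measurable
  then show ?case
    by (simp add: lborel.borel_measurable_nn_integral case_prod_beta')
qed

lemma measurable_flat_integral_line [measurable]:
  assumes "Q \<in> borel_measurable sequences"
  shows "(\<lambda>y. flat_integral B Q i (\<lambda>n. v n + y * w n)) \<in> borel_measurable borel"
  by (rule measurable_compose[OF _ measurable_flat_integral[OF assms]], rule measurable_abs_UNIV) measurable

lemma flat_integral_shift:
  assumes Q: "Q \<in> borel_measurable sequences" and "j < i"
  shows "flat_integral B Q i (\<lambda>n. v n + c * B j n) = flat_integral B Q i v"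
  using \<open>j < i\<close>
proof (induction i arbitrary: v)
  case (Suc i)
  show ?case
  proof (cases "j = i")
    case True
    have "flat_integral B Q (Suc i) v = (\<integral>\<^sup>+y. flat_integral B Q i (\<lambda>n. v n + (c + 1 * y) * B i n) \<partial>lborel)"
      by (simp, subst nn_integral_real_affine[where c=1 and t=c])
         (simp_all add: measurable_flat_integral_line[OF Q])
    then show ?thesis using True by (simp add: algebra_simps)
  next
    case False
    then have "flat_integral B Q i (\<lambda>n. (v n + y * B i n) + c * B j n) = flat_integral B Q i (\<lambda>n. v n + y * B i n)" for y
      using Suc by simp
    then show ?thesis by (simp add: add_ac)
  qed
qed simp

lemma flat_integral_shifts:
  assumes "Q \<in> borel_measurable sequences" and "m \<le> i"
  shows "flat_integral B Q i (\<lambda>n. v n + (\<Sum>j<m. c j * B j n)) = flat_integral B Q i v"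
  using \<open>m \<le> i\<close>
proof (induction m)
  case (Suc m)
  then show ?case
    using flat_integral_shift[OF assms(1), of m i B "\<lambda>n. v n + (\<Sum>j<m. c j * B j n)" "c m"]
    by (simp add: add_ac)
qed simp

text \<open>Replacing the outermost direction by \<open>f\<^sub>i\<close> moves the inner integral by a vector in the span of the
directions over which it is taken, and this does not change it.\<close>

lemma flat_integral_unitriangular:
  assumes Q: "Q \<in> borel_measurable sequences"
    and f: "\<And>k n. f k n = B k n + (\<Sum>j<k. c k j * B j n)"
  shows "flat_integral f Q i v = flat_integral B Q i v"
proof (induction i arbitrary: v)
  case (Suc i)
  have "flat_integral B Q i (\<lambda>n. v n + y * f i n) = flat_integral B Q i (\<lambda>n. v n + y * B i n)" for y
    using flat_integral_shifts[OF Q order_refl, of B i "\<lambda>n. v n + y * B i n" "\<lambda>j. y * c i j"]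
    by (simp add: f distrib_left sum_distrib_left mult.assoc add.assoc)
  then show ?case by (simp add: Suc)
qed simp

lemma nn_integral_unfold_integers:
  fixes G :: "real \<Rightarrow> ennreal"
  assumes [measurable]: "G \<in> borel_measurable borel"
  shows "(\<integral>\<^sup>+y. G y \<partial>lborel)
       = (\<integral>\<^sup>+u. (\<integral>\<^sup>+z. G (of_int z + u) \<partial>count_space (UNIV :: int set)) * indicator {0..<1} u \<partial>lborel)"
proof -
  let ?Z = "count_space (UNIV :: int set)"
  have "G y = (\<integral>\<^sup>+z. G y * indicator {of_int z..<of_int z + 1} y \<partial>?Z)" for y
  proof -
    have eq: "indicator {of_int z..<of_int z + 1} y = (indicator {\<lfloor>y\<rfloor>} z :: ennreal)" for z
      using floor_eq_iff[of y z] by (auto simp: indicator_def)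
    show ?thesis by (simp add: eq nn_integral_cmult)
  qed
  then have "(\<integral>\<^sup>+y. G y \<partial>lborel) = (\<integral>\<^sup>+y. \<integral>\<^sup>+z. G y * indicator {of_int z..<of_int z + 1} y \<partial>?Z \<partial>lborel)"
    by simp
  also have "\<dots> = (\<integral>\<^sup>+z. \<integral>\<^sup>+y. G y * indicator {of_int z..<of_int z + 1} y \<partial>lborel \<partial>?Z)"
    by (rule nn_integral_count_space_nn_integral) auto
  also have "\<dots> = (\<integral>\<^sup>+z. \<integral>\<^sup>+u. G (of_int z + u) * indicator {0..<1} u \<partial>lborel \<partial>?Z)"
  proof (rule nn_integral_cong)
    fix z :: int
    show "(\<integral>\<^sup>+y. G y * indicator {of_int z..<of_int z + 1} y \<partial>lborel)
        = (\<integral>\<^sup>+u. G (of_int z + u) * indicator {0..<1} u \<partial>lborel)"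
      by (subst nn_integral_real_affine[where c=1 and t="of_int z"])
         (auto intro!: nn_integral_cong simp: indicator_def)
  qed
  also have "\<dots> = (\<integral>\<^sup>+u. \<integral>\<^sup>+z. G (of_int z + u) * indicator {0..<1} u \<partial>?Z \<partial>lborel)"
    by (rule nn_integral_count_space_nn_integral[symmetric]) auto
  also have "\<dots> = (\<integral>\<^sup>+u. (\<integral>\<^sup>+z. G (of_int z + u) \<partial>?Z) * indicator {0..<1} u \<partial>lborel)"
    by (simp add: nn_integral_multc)
  finally show ?thesis .
qed

text \<open>Coefficient vectors whose entries below \<open>i\<close> are not chosen yet; they are set to 0 so that vectors of all
lengths live in one type.\<close>

definition int_vectors :: "nat \<Rightarrow> nat \<Rightarrow> (nat \<Rightarrow> int) set" where
  "int_vectors i N = {a. \<forall>k. a k \<noteq> 0 \<longrightarrow> i \<le> k \<and> k < N}"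

lemma int_vectors_self: "int_vectors N N = {\<lambda>_. 0}"
  unfolding int_vectors_def by fastforce

lemma countable_int_vectors: "countable (int_vectors i N)"
proof (rule countable_image_inj_on[of "\<lambda>a. map a [0..<N]"])
  show "inj_on (\<lambda>a. map a [0..<N]) (int_vectors i N)"
  proof (rule inj_onI, rule ext)
    fix a b k assume *: "a \<in> int_vectors i N" "b \<in> int_vectors i N" "map a [0..<N] = map b [0..<N]"
    show "a k = b k"
    proof (cases "k < N")
      case True with *(3) show ?thesis by (simp add: map_eq_conv)
    next
      case False with *(1,2) show ?thesis by (force simp: int_vectors_def)
    qed
  qed
qed auto

lemma bij_int_vectors:
  assumes "i < N"
  shows "bij_betw (\<lambda>(a, z). a(i := z)) (int_vectors (Suc i) N \<times> UNIV) (int_vectors i N)"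
proof (rule bij_betwI[where g="\<lambda>a. (a(i := 0), a i)"])
  show "(\<lambda>(a, z). a(i := z)) \<in> int_vectors (Suc i) N \<times> UNIV \<rightarrow> int_vectors i N"
    using assms by (auto simp: int_vectors_def split: if_splits)
  show "(\<lambda>a. (a(i := 0), a i)) \<in> int_vectors i N \<rightarrow> int_vectors (Suc i) N \<times> UNIV"
    using assms by (auto simp: int_vectors_def split: if_splits)
  show "\<And>x. x \<in> int_vectors (Suc i) N \<times> UNIV \<Longrightarrow>
      (case case x of (a, z) \<Rightarrow> a(i := z) of a \<Rightarrow> (a(i := 0), a i)) = x"
    by (force simp: int_vectors_def fun_eq_iff)
qed auto

lemma nn_integral_int_vectors:
  assumes "i < N"
  shows "(\<integral>\<^sup>+a. \<integral>\<^sup>+z. G (a(i := z)) \<partial>count_space UNIV \<partial>count_space (int_vectors (Suc i) N))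
       = (\<integral>\<^sup>+a. G a \<partial>count_space (int_vectors i N))"
proof -
  let ?A = "count_space (int_vectors (Suc i) N)" and ?Z = "count_space (UNIV :: int set)"
  interpret Z: sigma_finite_measure ?Z by (simp add: sigma_finite_measure_count_space_countable)
  have pair: "?A \<Otimes>\<^sub>M ?Z = count_space (int_vectors (Suc i) N \<times> UNIV)"
    by (simp add: pair_measure_countable countable_int_vectors)
  have "(\<integral>\<^sup>+a. G a \<partial>count_space (int_vectors i N))
      = (\<integral>\<^sup>+p. G ((\<lambda>(a, z). a(i := z)) p) \<partial>count_space (int_vectors (Suc i) N \<times> UNIV))"
    by (rule nn_integral_bij_count_space[symmetric, OF bij_int_vectors[OF assms]])
  also have "\<dots> = (\<integral>\<^sup>+p. G ((fst p)(i := snd p)) \<partial>(?A \<Otimes>\<^sub>M ?Z))"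
    by (simp add: pair case_prod_beta')
  also have "\<dots> = (\<integral>\<^sup>+a. \<integral>\<^sup>+z. G (a(i := z)) \<partial>?Z \<partial>?A)"
    by (subst Z.nn_integral_fst[symmetric]) (simp_all add: pair)
  finally show ?thesis ..
qed

lemma measurable_nn_integral_count_space:
  fixes f :: "'i \<Rightarrow> 'a \<Rightarrow> ennreal"
  assumes "countable I" and "\<And>i. i \<in> I \<Longrightarrow> f i \<in> borel_measurable M"
  shows "(\<lambda>x. \<integral>\<^sup>+i. f i x \<partial>count_space I) \<in> borel_measurable M"
proof -
  interpret sigma_finite_measure "count_space I"
    by (rule sigma_finite_measure_count_space_countable) fact
  have "(\<lambda>p. f (fst p) (snd p)) \<in> borel_measurable (count_space I \<Otimes>\<^sub>M M)"
    using assms by (intro measurable_pair_measure_countable1) auto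
  from measurable_pair_swap[OF this] show ?thesis
    by (intro borel_measurable_nn_integral) (simp add: case_prod_beta')
qed

text \<open>The integral over \<open>\<real>\<^sup>N\<close> is the integral over the unit cube of shifts \<open>s\<close> of the sum over the translate
\<open>s + \<int>\<^sup>N\<close>. The induction turns one coordinate after the other, from the innermost, from a sum over a
translate of the integers into an integral; at each stage the bound holds for all shifts of the
remaining coordinates.\<close>

lemma blichfeldt:
  fixes B :: "nat \<Rightarrow> nat \<Rightarrow> real" and C :: ennreal
  assumes Q: "Q \<in> borel_measurable sequences"
    and bound: "\<And>s. (\<integral>\<^sup>+a. Q (\<lambda>n. \<Sum>k<N. (of_int (a k) + s k) * B k n) \<partial>count_space (int_vectors 0 N)) \<le> C"
  shows "flat_integral B Q N (\<lambda>_. 0) \<le> C"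
proof -
  define V where "V s i a = (\<lambda>n. \<Sum>k=i..<N. (of_int (a k) + s k) * B k n)" for s i and a :: "nat \<Rightarrow> int"
  have "(\<integral>\<^sup>+a. flat_integral B Q i (V s i a) \<partial>count_space (int_vectors i N)) \<le> C" if "i \<le> N" for i s
    using that
  proof (induction i arbitrary: s)
    case 0
    show ?case using bound[of s] by (simp add: V_def atLeast0LessThan)
  next
    case (Suc i)
    then have "i < N" by simp
    let ?A = "count_space (int_vectors (Suc i) N)" and ?Z = "count_space (UNIV :: int set)"
    have V_step: "(\<lambda>n. V s (Suc i) a n + (of_int z + u) * B i n) = V (s(i := u)) i (a(i := z))" for a z u
    proof
      fix n
      have "(\<Sum>k=Suc i..<N. (of_int ((a(i := z)) k) + (s(i := u)) k) * B k n)
          = (\<Sum>k=Suc i..<N. (of_int (a k) + s k) * B k n)"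
        by (intro sum.cong) auto
      then show "V s (Suc i) a n + (of_int z + u) * B i n = V (s(i := u)) i (a(i := z)) n"
        using \<open>i < N\<close> by (simp add: V_def sum.atLeast_Suc_lessThan)
    qed
    have "(\<integral>\<^sup>+a. flat_integral B Q (Suc i) (V s (Suc i) a) \<partial>?A)
        = (\<integral>\<^sup>+a. \<integral>\<^sup>+u. (\<integral>\<^sup>+z. flat_integral B Q i (V (s(i := u)) i (a(i := z))) \<partial>?Z) * indicator {0..<1} u \<partial>lborel \<partial>?A)"
      by (simp add: nn_integral_unfold_integers measurable_flat_integral_line[OF Q] V_step)
    also have "\<dots> = (\<integral>\<^sup>+u. \<integral>\<^sup>+a. (\<integral>\<^sup>+z. flat_integral B Q i (V (s(i := u)) i (a(i := z))) \<partial>?Z) * indicator {0..<1} u \<partial>?A \<partial>lborel)"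
    proof (rule nn_integral_count_space_nn_integral[symmetric, OF countable_int_vectors])
      fix a :: "nat \<Rightarrow> int"
      have "(\<lambda>u. flat_integral B Q i (\<lambda>n. V s (Suc i) a n + (of_int z + u) * B i n)) \<in> borel_measurable lborel" for z
        using measurable_compose[of "\<lambda>u. of_int z + u" borel borel, OF _ measurable_flat_integral_line[OF Q]] by simp
      then have [measurable]: "(\<lambda>u. \<integral>\<^sup>+z. flat_integral B Q i (V (s(i := u)) i (a(i := z))) \<partial>?Z) \<in> borel_measurable lborel"
        unfolding V_step by (intro measurable_nn_integral_count_space) auto
      show "(\<lambda>u. (\<integral>\<^sup>+z. flat_integral B Q i (V (s(i := u)) i (a(i := z))) \<partial>?Z) * indicator {0..<1} u) \<in> borel_measurable lborel"
        by measurable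
    qed
    also have "\<dots> = (\<integral>\<^sup>+u. (\<integral>\<^sup>+a. flat_integral B Q i (V (s(i := u)) i a) \<partial>count_space (int_vectors i N)) * indicator {0..<1} u \<partial>lborel)"
      by (simp add: nn_integral_multc nn_integral_int_vectors[OF \<open>i < N\<close>, where G="\<lambda>a. flat_integral B Q i (V (s(i := _)) i a)"])
    also have "\<dots> \<le> (\<integral>\<^sup>+u. C * indicator {0..<1} (u::real) \<partial>lborel)"
      using Suc by (intro nn_integral_mono mult_right_mono) auto
    also have "\<dots> = C" by (simp add: nn_integral_cmult_indicator)
    finally show ?case .
  qed
  from this[of N "\<lambda>_. 0"] show ?thesis
    by (simp add: int_vectors_self V_def nn_integral_count_space_finite)
qed

section \<open>Gaussian averages and Jensen's inequality\<close>

interpretation std_normal: real_distribution std_normal_distribution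
  by (rule real_dist_normal_dist)

definition gaussian_average :: "(real \<Rightarrow> real) \<Rightarrow> real \<Rightarrow> real \<Rightarrow> real" where
  "gaussian_average l x s = (LINT g|std_normal_distribution. l (x + s * g))"

text \<open>Both sides have the characteristic function \<open>exp (- (a\<^sup>2 + b\<^sup>2) t\<^sup>2 / 2)\<close>. This argument includes the
degenerate cases \<open>a = 0\<close> and \<open>b = 0\<close>, in which there is no density.\<close>

lemma distr_normal_pair:
  "distr (std_normal_distribution \<Otimes>\<^sub>M std_normal_distribution) borel (\<lambda>(g, h). a * g + b * h)
   = distr std_normal_distribution borel (\<lambda>g. sqrt (a\<^sup>2 + b\<^sup>2) * g)"
proof (rule Levy_uniqueness)
  let ?\<nu> = std_normal_distribution
  interpret P: pair_prob_space ?\<nu> ?\<nu> ..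
  have [measurable_cong]: "sets ?\<nu> = sets borel" by simp
  show "real_distribution (distr (?\<nu> \<Otimes>\<^sub>M ?\<nu>) borel (\<lambda>(g, h). a * g + b * h))"
    by (rule P.real_distribution_distr) measurable
  show "real_distribution (distr ?\<nu> borel (\<lambda>g. sqrt (a\<^sup>2 + b\<^sup>2) * g))"
    by (rule std_normal.real_distribution_distr) measurable
  have char_scale: "(CLINT g|?\<nu>. iexp (c * g)) = exp (- (c\<^sup>2) / 2)" for c :: real
    using fun_cong[OF char_std_normal_distribution, of c] by (simp add: char_def)
  show "char (distr (?\<nu> \<Otimes>\<^sub>M ?\<nu>) borel (\<lambda>(g, h). a * g + b * h))
      = char (distr ?\<nu> borel (\<lambda>g. sqrt (a\<^sup>2 + b\<^sup>2) * g))"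
  proof
    fix t
    have "integrable (?\<nu> \<Otimes>\<^sub>M ?\<nu>) (\<lambda>x. iexp (t * (a * fst x + b * snd x)))"
      by (rule P.integrable_const_bound[where B=1]) (simp, measurable)
    then have int: "integrable (?\<nu> \<Otimes>\<^sub>M ?\<nu>) (\<lambda>(g, h). iexp (t * a * g) * iexp (t * b * h))"
      by (simp add: case_prod_beta' exp_add[symmetric] algebra_simps)
    have "char (distr (?\<nu> \<Otimes>\<^sub>M ?\<nu>) borel (\<lambda>(g, h). a * g + b * h)) t
        = (CLINT x|(?\<nu> \<Otimes>\<^sub>M ?\<nu>). iexp (t * (a * fst x + b * snd x)))"
      unfolding char_def by (subst integral_distr) (auto simp: case_prod_beta')
    also have "\<dots> = (CLINT x|(?\<nu> \<Otimes>\<^sub>M ?\<nu>). (case x of (g, h) \<Rightarrow> iexp (t * a * g) * iexp (t * b * h)))"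
      by (simp add: case_prod_beta' exp_add[symmetric] algebra_simps)
    also have "\<dots> = (CLINT g|?\<nu>. CLINT h|?\<nu>. iexp (t * a * g) * iexp (t * b * h))"
      using P.integral_fst'[OF int] by simp
    also have "\<dots> = exp (- ((t * a)\<^sup>2) / 2) * exp (- ((t * b)\<^sup>2) / 2)"
      by (simp only: integral_mult_right_zero integral_mult_left_zero char_scale) simp
    also have "\<dots> = exp (- ((t * sqrt (a\<^sup>2 + b\<^sup>2))\<^sup>2) / 2)"
      by (simp add: exp_add[symmetric] of_real_mult[symmetric] power_mult_distrib add_divide_distrib algebra_simps del: of_real_mult)
    also have "\<dots> = (CLINT g|?\<nu>. iexp (t * sqrt (a\<^sup>2 + b\<^sup>2) * g))"
      by (rule char_scale[symmetric])
    also have "\<dots> = char (distr ?\<nu> borel (\<lambda>g. sqrt (a\<^sup>2 + b\<^sup>2) * g)) t"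
      unfolding char_def by (subst integral_distr) (auto simp: mult_ac)
    finally show "char (distr (?\<nu> \<Otimes>\<^sub>M ?\<nu>) borel (\<lambda>(g, h). a * g + b * h)) t = \<dots>" .
  qed
qed

definition linear_growth :: "(real \<Rightarrow> real) \<Rightarrow> bool" where
  "linear_growth l \<longleftrightarrow> l \<in> borel_measurable borel \<and> (\<exists>C. \<forall>x. \<bar>l x\<bar> \<le> C * (1 + \<bar>x\<bar>))"

lemma integrable_std_normal_abs: "integrable std_normal_distribution (\<lambda>g. \<bar>g\<bar>)"
  using integrable_std_normal_distribution_moment[of 1] by simp

lemma linear_growthE:
  assumes "linear_growth l"
  obtains C where "C \<ge> 0" "\<And>x. \<bar>l x\<bar> \<le> C * (1 + \<bar>x\<bar>)"
proof -
  from assms obtain C where C: "\<And>x. \<bar>l x\<bar> \<le> C * (1 + \<bar>x\<bar>)" by (auto simp: linear_growth_def)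
  from C[of 0] have "C \<ge> 0" by simp
  with C show ?thesis using that by blast
qed

lemma gaussian_average_semigroup:
  assumes l: "linear_growth l"
  shows "integrable std_normal_distribution (\<lambda>g. gaussian_average l (x + a * g) b)"
    and "(LINT g|std_normal_distribution. gaussian_average l (x + a * g) b) = gaussian_average l x (sqrt (a\<^sup>2 + b\<^sup>2))"
proof -
  let ?\<nu> = std_normal_distribution
  interpret P: pair_prob_space ?\<nu> ?\<nu> ..
  have [measurable_cong]: "sets ?\<nu> = sets borel" by simp
  have [measurable]: "l \<in> borel_measurable borel" using l by (simp add: linear_growth_def)
  obtain C where C: "C \<ge> 0" "\<And>x. \<bar>l x\<bar> \<le> C * (1 + \<bar>x\<bar>)" using linear_growthE[OF l] by blast
  have int1: "integrable (?\<nu> \<Otimes>\<^sub>M ?\<nu>) (\<lambda>z. \<bar>fst z\<bar>)" "integrable (?\<nu> \<Otimes>\<^sub>M ?\<nu>) (\<lambda>z. \<bar>snd z\<bar>)"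
  proof -
    show snd: "integrable (?\<nu> \<Otimes>\<^sub>M ?\<nu>) (\<lambda>z. \<bar>snd z\<bar>)"
    proof (rule P.Fubini_integrable)
      show "integrable ?\<nu> (\<lambda>g. LINT h|?\<nu>. norm \<bar>snd (g, h)\<bar>)" by simp
      show "AE g in ?\<nu>. integrable ?\<nu> (\<lambda>h. \<bar>snd (g, h)\<bar>)"
        using integrable_std_normal_abs by simp
    qed measurable
    show "integrable (?\<nu> \<Otimes>\<^sub>M ?\<nu>) (\<lambda>z. \<bar>fst z\<bar>)"
      using P.integrable_product_swap[OF snd] by (simp add: case_prod_beta')
  qed
  have int: "integrable (?\<nu> \<Otimes>\<^sub>M ?\<nu>) (\<lambda>(g, h). l (x + a * g + b * h))"
  proof (rule Bochner_Integration.integrable_bound)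
    show "integrable (?\<nu> \<Otimes>\<^sub>M ?\<nu>) (\<lambda>z. C * (1 + (\<bar>x\<bar> + \<bar>a\<bar> * \<bar>fst z\<bar> + \<bar>b\<bar> * \<bar>snd z\<bar>)))"
      using int1 by (intro Bochner_Integration.integrable_add integrable_mult_right P.integrable_const) auto
    show "AE z in ?\<nu> \<Otimes>\<^sub>M ?\<nu>. norm (case z of (g, h) \<Rightarrow> l (x + a * g + b * h))
        \<le> norm (C * (1 + (\<bar>x\<bar> + \<bar>a\<bar> * \<bar>fst z\<bar> + \<bar>b\<bar> * \<bar>snd z\<bar>)))"
    proof (intro AE_I2, clarify)
      fix g h
      have "\<bar>x + a * g + b * h\<bar> \<le> \<bar>x\<bar> + \<bar>a\<bar> * \<bar>g\<bar> + \<bar>b\<bar> * \<bar>h\<bar>"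
        unfolding abs_mult[symmetric] by linarith
      then have "C * (1 + \<bar>x + a * g + b * h\<bar>) \<le> C * (1 + (\<bar>x\<bar> + \<bar>a\<bar> * \<bar>g\<bar> + \<bar>b\<bar> * \<bar>h\<bar>))"
        using C(1) by (intro mult_left_mono) auto
      with C(2)[of "x + a * g + b * h"]
      show "norm (l (x + a * g + b * h)) \<le> norm (C * (1 + (\<bar>x\<bar> + \<bar>a\<bar> * \<bar>fst (g, h)\<bar> + \<bar>b\<bar> * \<bar>snd (g, h)\<bar>)))"
        by (simp add: order_trans[OF _ abs_ge_self])
    qed
  qed measurable
  show "integrable ?\<nu> (\<lambda>g. gaussian_average l (x + a * g) b)"
    unfolding gaussian_average_def using P.integrable_fst'[OF int] by simp
  have "(LINT g|?\<nu>. gaussian_average l (x + a * g) b) = (LINT z|(?\<nu> \<Otimes>\<^sub>M ?\<nu>). (case z of (g, h) \<Rightarrow> l (x + a * g + b * h)))"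
    unfolding gaussian_average_def using P.integral_fst'[OF int] by simp
  also have "\<dots> = (LINT y|distr (?\<nu> \<Otimes>\<^sub>M ?\<nu>) borel (\<lambda>(g, h). a * g + b * h). l (x + y))"
    by (subst integral_distr) (auto simp: case_prod_beta' add.assoc)
  also have "\<dots> = gaussian_average l x (sqrt (a\<^sup>2 + b\<^sup>2))"
    unfolding distr_normal_pair gaussian_average_def by (subst integral_distr) auto
  finally show "(LINT g|?\<nu>. gaussian_average l (x + a * g) b) = gaussian_average l x (sqrt (a\<^sup>2 + b\<^sup>2))" .
qed

text \<open>Jensen's inequality for the density \<open>\<gamma>\<close> of a centred normal variable with standard deviation \<open>r\<close>, applied
to \<open>exp U = \<gamma> exp (U - ln \<gamma>)\<close>. The added constant is its differential entropy
\<open>ln (r \<surd>(2 \<pi> e))\<close>.\<close>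

lemma gaussian_jensen:
  fixes U :: "real \<Rightarrow> real"
  assumes [measurable]: "U \<in> borel_measurable borel" and "r > 0"
    and int: "integrable std_normal_distribution (\<lambda>g. U (r * g))"
  shows "ennreal (exp ((LINT g|std_normal_distribution. U (r * g)) + (1/2 + ln (2 * pi) / 2 + ln r)))
     \<le> (\<integral>\<^sup>+y. ennreal (exp (U y)) \<partial>lborel)"
proof -
  let ?\<nu> = std_normal_distribution
  define w where "w g = U (r * g) + (ln (2 * pi) / 2 + g\<^sup>2 / 2)" for g
  have sq: "integrable ?\<nu> (\<lambda>g. g\<^sup>2)" "(LINT g|?\<nu>. g\<^sup>2) = 1"
    using std_normal_distribution_even_moments[of 1] by simp_all
  have wint: "integrable ?\<nu> w"
    unfolding w_def by (intro Bochner_Integration.integrable_add int) (auto intro!: Bochner_Integration.integrable_add simp: sq)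
  define m where "m = (LINT g|?\<nu>. w g)"
  have m: "m = (LINT g|?\<nu>. U (r * g)) + (1/2 + ln (2 * pi) / 2)"
    unfolding m_def w_def using int sq std_normal.prob_space by simp
  have dens: "std_normal_density g * exp (w g) = exp (U (r * g))" for g
  proof -
    have "w g = U (r * g) + (ln (sqrt (2 * pi)) + g\<^sup>2 / 2)" by (simp add: w_def ln_sqrt)
    then have "exp (w g) = exp (U (r * g)) * (sqrt (2 * pi) * exp (g\<^sup>2 / 2))"
      by (simp only: exp_add) simp
    moreover have "std_normal_density g * (sqrt (2 * pi) * exp (g\<^sup>2 / 2)) = 1"
      by (simp add: std_normal_density_def exp_minus)
    ultimately show ?thesis by simp
  qed
  \<comment> \<open>The tangent of the exponential function at the mean \<open>m\<close> has integral \<open>exp m\<close>.\<close>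
  have "ennreal (exp m) = ennreal (LINT g|?\<nu>. exp m * (1 + (w g - m)))"
    using wint std_normal.prob_space by (simp add: m_def[symmetric])
  also have "\<dots> \<le> (\<integral>\<^sup>+g. ennreal (exp m * (1 + (w g - m))) \<partial>?\<nu>)"
  proof -
    let ?f = "\<lambda>g. exp m * (1 + (w g - m))"
    have i: "integrable ?\<nu> ?f" using wint by simp
    have "(\<integral>\<^sup>+g. ennreal (?f g) \<partial>?\<nu>) \<le> (\<integral>\<^sup>+g. ennreal (norm (?f g)) \<partial>?\<nu>)"
      by (intro nn_integral_mono ennreal_leI) simp
    also have "\<dots> < \<infinity>" using i by (simp only: integrable_iff_bounded)
    finally have "(\<integral>\<^sup>+g. ennreal (?f g) \<partial>?\<nu>) < \<infinity>" .
    moreover have "(LINT g|?\<nu>. ?f g) \<le> enn2real (\<integral>\<^sup>+g. ennreal (?f g) \<partial>?\<nu>)"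
      unfolding real_lebesgue_integral_def[OF i] by simp
    ultimately show ?thesis
      by (metis ennreal_enn2real ennreal_leI infinity_ennreal_def)
  qed
  also have "\<dots> \<le> (\<integral>\<^sup>+g. ennreal (exp (w g)) \<partial>?\<nu>)"
  proof (intro nn_integral_mono ennreal_leI)
    fix g
    have "exp m * (1 + (w g - m)) \<le> exp m * exp (w g - m)"
      by (intro mult_left_mono exp_ge_add_one_self) auto
    then show "exp m * (1 + (w g - m)) \<le> exp (w g)" by (simp add: exp_add[symmetric])
  qed
  also have "\<dots> = (\<integral>\<^sup>+g. ennreal (std_normal_density g) * ennreal (exp (w g)) \<partial>lborel)"
    by (subst nn_integral_density) (auto simp: w_def)
  also have "\<dots> = (\<integral>\<^sup>+g. ennreal (exp (U (r * g))) \<partial>lborel)"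
    by (simp add: ennreal_mult[symmetric] dens)
  finally have *: "ennreal (exp m) \<le> (\<integral>\<^sup>+g. ennreal (exp (U (r * g))) \<partial>lborel)" .
  have "(\<integral>\<^sup>+y. ennreal (exp (U y)) \<partial>lborel) = ennreal r * (\<integral>\<^sup>+g. ennreal (exp (U (r * g))) \<partial>lborel)"
    using \<open>r > 0\<close> by (subst nn_integral_real_affine[where c=r and t=0]) auto
  also have "\<dots> \<ge> ennreal r * ennreal (exp m)" by (intro mult_left_mono *) auto
  also have "ennreal r * ennreal (exp m) = ennreal (exp (m + ln r))"
    using \<open>r > 0\<close> by (simp add: ennreal_mult[symmetric] exp_add mult.commute)
  finally show ?thesis by (simp add: m add_ac)
qed

lemma gaussian_average_0: "gaussian_average l x 0 = l x"
  using std_normal.prob_space by (simp add: gaussian_average_def)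

lemma measurable_gaussian_average [measurable]:
  assumes [measurable]: "l \<in> borel_measurable borel"
  shows "(\<lambda>x. gaussian_average l x s) \<in> borel_measurable borel"
proof -
  have [measurable_cong]: "sets std_normal_distribution = sets borel" by simp
  show ?thesis unfolding gaussian_average_def
    by (intro std_normal.borel_measurable_lebesgue_integral) measurable
qed

text \<open>Jensen's inequality in one coordinate after the other. As the exponent is a sum of functions of single
values of the sequence, averaging over the next coordinate only raises the variances in these
functions, by the semigroup property.\<close>

lemma gaussian_lower_bound:
  assumes l: "\<And>n. n < M \<Longrightarrow> linear_growth (l n)" and "r > 0"
  shows "ennreal (exp ((\<Sum>n<M. gaussian_average (l n) (v n) (r * sqrt (\<Sum>k<i. (f k n)\<^sup>2))) + real i * (1/2 + ln (2 * pi) / 2 + ln r)))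
    \<le> flat_integral f (\<lambda>v. ennreal (exp (\<Sum>n<M. l n (v n)))) i v"
proof (induction i arbitrary: v)
  case 0
  show ?case by (simp add: gaussian_average_0)
next
  case (Suc i)
  let ?h = "1/2 + ln (2 * pi) / 2 + ln r"
  let ?t = "\<lambda>i n. r * sqrt (\<Sum>k<i. (f k n)\<^sup>2)"
  let ?U = "\<lambda>y. (\<Sum>n<M. gaussian_average (l n) (v n + y * f i n) (?t i n)) + real i * ?h"
  have sg: "integrable std_normal_distribution (\<lambda>g. gaussian_average (l n) (v n + (r * f i n) * g) (?t i n))"
     "(LINT g|std_normal_distribution. gaussian_average (l n) (v n + (r * f i n) * g) (?t i n)) = gaussian_average (l n) (v n) (?t (Suc i) n)"
    if "n < M" for n
  proof -
    have "sqrt ((r * f i n)\<^sup>2 + (?t i n)\<^sup>2) = ?t (Suc i) n"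
      using \<open>r > 0\<close> by (simp add: power_mult_distrib sum_nonneg distrib_left[symmetric] real_sqrt_mult add.commute)
    then show "integrable std_normal_distribution (\<lambda>g. gaussian_average (l n) (v n + (r * f i n) * g) (?t i n))"
     "(LINT g|std_normal_distribution. gaussian_average (l n) (v n + (r * f i n) * g) (?t i n)) = gaussian_average (l n) (v n) (?t (Suc i) n)"
      using gaussian_average_semigroup[OF l[OF that], where x="v n" and a="r * f i n" and b="?t i n"] by simp_all
  qed
  have meas: "?U \<in> borel_measurable borel"
  proof -
    have [measurable]: "(\<lambda>y. gaussian_average (l n) (v n + y * f i n) (?t i n)) \<in> borel_measurable borel" if "n < M" for n
      using l[OF that] by (intro measurable_compose[OF _ measurable_gaussian_average]) (auto simp: linear_growth_def)
    show ?thesis by (intro borel_measurable_add borel_measurable_sum) auto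
  qed
  have int: "integrable std_normal_distribution (\<lambda>g. \<Sum>n<M. gaussian_average (l n) (v n + (r * g) * f i n) (?t i n))"
    using sg(1) by (intro Bochner_Integration.integrable_sum) (simp add: mult_ac)
  have "(LINT g|std_normal_distribution. (\<Sum>n<M. gaussian_average (l n) (v n + (r * g) * f i n) (?t i n)))
      = (\<Sum>n<M. gaussian_average (l n) (v n) (?t (Suc i) n))"
    using sg by (subst Bochner_Integration.integral_sum) (simp_all add: mult_ac)
  then have "(LINT g|std_normal_distribution. ?U (r * g)) = (\<Sum>n<M. gaussian_average (l n) (v n) (?t (Suc i) n)) + real i * ?h"
    using int std_normal.prob_space by simp
  with gaussian_jensen[OF meas \<open>r > 0\<close>] int
  have "ennreal (exp ((\<Sum>n<M. gaussian_average (l n) (v n) (?t (Suc i) n)) + real i * ?h + ?h)) \<le> (\<integral>\<^sup>+y. ennreal (exp (?U y)) \<partial>lborel)"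
    by simp
  also have "\<dots> \<le> (\<integral>\<^sup>+y. flat_integral f (\<lambda>v. ennreal (exp (\<Sum>n<M. l n (v n)))) i (\<lambda>n. v n + y * f i n) \<partial>lborel)"
    by (intro nn_integral_mono Suc)
  finally have "ennreal (exp ((\<Sum>n<M. gaussian_average (l n) (v n) (?t (Suc i) n)) + (real i * ?h + ?h)))
      \<le> flat_integral f (\<lambda>v. ennreal (exp (\<Sum>n<M. l n (v n)))) (Suc i) v"
    by (simp only: flat_integral.simps add.assoc)
  moreover have "real (Suc i) * ?h = real i * ?h + ?h" by (simp only: of_nat_Suc distrib_right mult_1 add.commute)
  ultimately show ?case by (simp only:)
qed

section \<open>Weighted unit cells\<close>

text \<open>A probability distribution on the integers with mass \<open>p\<close> outside 0. The geometric decay keeps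
\<open>ln (cell_weight p j)\<close> of linear growth in \<open>j\<close>.\<close>

definition cell_weight :: "real \<Rightarrow> int \<Rightarrow> real" where
  "cell_weight p j = (if j = 0 then 1 - p else p / 2 ^ (nat \<bar>j\<bar> + 1))"

lemma cell_weight_pos: "0 < p \<Longrightarrow> p < 1 \<Longrightarrow> cell_weight p j > 0"
  by (simp add: cell_weight_def)

lemma cell_weight_le_1: "0 < p \<Longrightarrow> p < 1 \<Longrightarrow> cell_weight p j \<le> 1"
proof -
  assume p: "0 < p" "p < 1"
  have "p / 2 ^ (nat \<bar>j\<bar> + 1) \<le> p / 1" using p by (intro divide_left_mono one_le_power) auto
  with p show ?thesis unfolding cell_weight_def by (simp only: div_by_1 split: if_split) linarith
qed

lemma sum_cell_weight:
  assumes p: "0 < p" "p < 1"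
  shows "(\<integral>\<^sup>+j. ennreal (cell_weight p j) \<partial>count_space UNIV) = 1"
proof -
  let ?Z = "count_space (UNIV :: int set)" and ?N = "count_space (UNIV :: nat set)"
  let ?c = "\<lambda>m. ennreal (p / 2 ^ (m + 2))"
  let ?I = "\<lambda>m j. indicator {int m + 1} j + indicator {- (int m + 1)} j :: ennreal"
  have "ennreal (cell_weight p j) = ennreal (1 - p) * indicator {0} j + (\<integral>\<^sup>+m. ?c m * ?I m j \<partial>?N)" for j
  proof (cases "j = 0")
    case True
    then have "?I m j = 0" for m by (auto simp: indicator_def)
    then show ?thesis using True by (simp add: cell_weight_def)
  next
    case False
    then have "?I m j = indicator {nat \<bar>j\<bar> - 1} m" for m by (auto simp: indicator_def)
    moreover have "nat \<bar>j\<bar> - 1 + 2 = nat \<bar>j\<bar> + 1" using False by auto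
    ultimately show ?thesis using False by (simp add: cell_weight_def del: add_2_eq_Suc')
  qed
  then have "(\<integral>\<^sup>+j. ennreal (cell_weight p j) \<partial>?Z)
     = ennreal (1 - p) + (\<integral>\<^sup>+j. \<integral>\<^sup>+m. ?c m * ?I m j \<partial>?N \<partial>?Z)"
    by (simp add: nn_integral_add nn_integral_cmult)
  also have "(\<integral>\<^sup>+j. \<integral>\<^sup>+m. ?c m * ?I m j \<partial>?N \<partial>?Z) = (\<integral>\<^sup>+m. \<integral>\<^sup>+j. ?c m * ?I m j \<partial>?Z \<partial>?N)"
    by (rule nn_integral_count_space_nn_integral) auto
  also have "\<dots> = (\<integral>\<^sup>+m. ennreal (p * (1/2) ^ Suc m) \<partial>?N)"
  proof (intro nn_integral_cong)
    fix m
    have "(\<integral>\<^sup>+j. ?c m * ?I m j \<partial>?Z) = ?c m * 2"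
      by (subst nn_integral_cmult) (simp_all add: nn_integral_add)
    also have "\<dots> = ennreal (p / 2 ^ (m + 2) * 2)" using p by (subst ennreal_mult) auto
    also have "p / 2 ^ (m + 2) * 2 = p * (1/2) ^ Suc m" by (simp add: power_divide)
    finally show "(\<integral>\<^sup>+j. ?c m * ?I m j \<partial>?Z) = ennreal (p * (1/2) ^ Suc m)" .
  qed
  also have "\<dots> = ennreal p"
    unfolding nn_integral_count_space_nat
    using p sums_mult[OF power_half_series, of p] by (intro suminf_ennreal_eq) auto
  also have "ennreal (1 - p) + ennreal p = 1" using p by (simp add: ennreal_plus[symmetric] del: ennreal_plus)
  finally show ?thesis .
qed

text \<open>Grouping the points of \<open>S\<close> by their cell \<open>\<beta>\<close> gives \<open>C\<close> times the sum over all \<open>\<beta>\<close> of a product of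
probabilities. The induction on \<open>M\<close> performs that sum one coordinate at a time.\<close>

lemma cell_count_bound:
  fixes b :: "nat \<Rightarrow> 'a \<Rightarrow> int"
  assumes p: "\<And>n. n < M \<Longrightarrow> 0 < p n \<and> p n < 1"
    and cells: "\<And>\<beta>. emeasure (count_space S) {a \<in> S. \<forall>n<M. b n a = \<beta> n} \<le> C"
  shows "(\<integral>\<^sup>+a. (\<Prod>n<M. ennreal (cell_weight (p n) (b n a))) \<partial>count_space S) \<le> C"
  using assms
proof (induction M arbitrary: S)
  case 0
  then show ?case by simp
next
  case (Suc M)
  let ?Z = "count_space (UNIV :: int set)" and ?S = "count_space S"
  let ?P = "\<lambda>a. \<Prod>n<M. ennreal (cell_weight (p n) (b n a))"
  let ?q = "\<lambda>j. ennreal (cell_weight (p M) j)"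
  have "(\<integral>\<^sup>+a. (\<Prod>n<Suc M. ennreal (cell_weight (p n) (b n a))) \<partial>?S)
      = (\<integral>\<^sup>+a. \<integral>\<^sup>+j. (?P a * ?q j) * indicator {b M a} j \<partial>?Z \<partial>?S)"
    by simp
  also have "\<dots> = (\<integral>\<^sup>+j. \<integral>\<^sup>+a. (?P a * ?q j) * indicator {b M a} j \<partial>?S \<partial>?Z)"
    by (rule nn_integral_count_space_nn_integral) auto
  also have "\<dots> = (\<integral>\<^sup>+j. ?q j * (\<integral>\<^sup>+a. ?P a \<partial>count_space {a \<in> S. b M a = j}) \<partial>?Z)"
  proof (intro nn_integral_cong)
    fix j
    have "(\<integral>\<^sup>+a. (?P a * ?q j) * indicator {b M a} j \<partial>?S) = (\<integral>\<^sup>+a. ?q j * (?P a * indicator {a \<in> S. b M a = j} a) \<partial>?S)"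
      by (intro nn_integral_cong) (auto simp: indicator_def mult_ac)
    also have "\<dots> = ?q j * (\<integral>\<^sup>+a. ?P a * indicator {a \<in> S. b M a = j} a \<partial>?S)"
      by (rule nn_integral_cmult) simp
    also have "(\<integral>\<^sup>+a. ?P a * indicator {a \<in> S. b M a = j} a \<partial>?S) = (\<integral>\<^sup>+a. ?P a \<partial>count_space {a \<in> S. b M a = j})"
      by (simp add: nn_integral_count_space_indicator[of S] nn_integral_count_space_indicator[of "{a \<in> S. b M a = j}"])
         (auto intro!: nn_integral_cong simp: indicator_def)
    finally show "(\<integral>\<^sup>+a. (?P a * ?q j) * indicator {b M a} j \<partial>?S)
        = ?q j * (\<integral>\<^sup>+a. ?P a \<partial>count_space {a \<in> S. b M a = j})" .
  qed
  also have "\<dots> \<le> (\<integral>\<^sup>+j. ?q j * C \<partial>?Z)"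
  proof (intro nn_integral_mono mult_left_mono Suc.IH)
    fix j \<beta>
    let ?T = "{a \<in> S. b M a = j}"
    have "{a \<in> ?T. \<forall>n<M. b n a = \<beta> n} = {a \<in> S. \<forall>n<Suc M. b n a = (\<beta>(M := j)) n}"
      by (auto simp: less_Suc_eq)
    then have "emeasure (count_space ?T) {a \<in> ?T. \<forall>n<M. b n a = \<beta> n}
        = emeasure (count_space S) {a \<in> S. \<forall>n<Suc M. b n a = (\<beta>(M := j)) n}"
      by (subst (1 2) emeasure_count_space) auto
    with Suc.prems(2)[of "\<beta>(M := j)"]
    show "emeasure (count_space ?T) {a \<in> ?T. \<forall>n<M. b n a = \<beta> n} \<le> C" by simp
  qed (use Suc.prems in auto)
  also have "\<dots> = C" using sum_cell_weight[of "p M"] Suc.prems(1)[of M] by (simp add: nn_integral_multc)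
  finally show ?case .
qed

lemma round_eq_imp_close:
  fixes x y :: real
  assumes "round x = round y"
  shows "\<bar>x - y\<bar> \<le> 1"
  using of_int_round_abs_le[of x] of_int_round_abs_le[of y] assms by linarith

section \<open>The Gaussian cost of a cell\<close>

lemma gaussian_tail_mean:
  assumes "a \<ge> 0"
  shows "(\<integral>\<^sup>+g. ennreal (\<bar>g\<bar> * indicator {x. a \<le> \<bar>x\<bar>} g) \<partial>std_normal_distribution) = 2 * ennreal (std_normal_density a)"
proof -
  let ?f = "\<lambda>g. ennreal (g * std_normal_density g) * indicator {a..} g"
  have right: "(\<integral>\<^sup>+g. ?f g \<partial>lborel) = ennreal (0 - (- std_normal_density a))"
  proof (rule nn_integral_FTC_atLeast)
    show "((\<lambda>g. - std_normal_density g) \<longlongrightarrow> 0) at_top"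
      unfolding std_normal_density_def by real_asymp
    show "DERIV (\<lambda>g. - std_normal_density g) x :> x * std_normal_density x" for x
      unfolding std_normal_density_def by (auto intro!: derivative_eq_intros simp: field_simps)
  qed (use assms in auto)
  have left: "(\<integral>\<^sup>+g. ?f (- g) \<partial>lborel) = (\<integral>\<^sup>+g. ?f g \<partial>lborel)"
    by (subst (2) nn_integral_real_affine[where c="-1" and t=0]) auto
  have "AE g in lborel. ennreal (std_normal_density g) * ennreal (\<bar>g\<bar> * indicator {x. a \<le> \<bar>x\<bar>} g) = ?f g + ?f (- g)"
    using AE_lborel_singleton[of 0]
    by eventually_elim
       (use assms in \<open>auto simp: indicator_def std_normal_density_def ennreal_mult[symmetric] mult.commute\<close>)
  then have "(\<integral>\<^sup>+g. ennreal (\<bar>g\<bar> * indicator {x. a \<le> \<bar>x\<bar>} g) \<partial>std_normal_distribution) = (\<integral>\<^sup>+g. ?f g + ?f (- g) \<partial>lborel)"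
    by (subst nn_integral_density) (auto intro!: nn_integral_cong_AE)
  also have "\<dots> = (\<integral>\<^sup>+g. ?f g \<partial>lborel) + (\<integral>\<^sup>+g. ?f (- g) \<partial>lborel)"
    by (rule nn_integral_add) auto
  also have "\<dots> = 2 * ennreal (std_normal_density a)" by (simp only: left right) (simp add: mult_2)
  finally show ?thesis .
qed

text \<open>The logarithm of the weight of the cell, in one coordinate, that contains the value \<open>x\<close>.\<close>

definition log_cell :: "real \<Rightarrow> real \<Rightarrow> real" where
  "log_cell p x = ln (cell_weight p (round x))"

text \<open>In the central cell only \<open>ln (1 - p)\<close> is paid. Elsewhere \<open>\<bar>x\<bar> \<ge> 1/2\<close>, so constants may be bounded by multiples
of \<open>\<bar>x\<bar>\<close>; then a single Gaussian integral, the one with an elementary value, controls the whole tail.\<close>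

lemma log_cell_lower:
  assumes p: "0 < p" "p < 1"
  shows "- (p / (1 - p)) - (2 * ln (1 / p) + 4 * ln 2) * (\<bar>x\<bar> * indicator {y. 1/2 \<le> \<bar>y\<bar>} x) \<le> log_cell p x"
proof -
  have K: "ln (1 / p) \<ge> 0" using p by simp
  show ?thesis
  proof (cases "round x = 0")
    case True
    have "- ln (1 - p) = ln (1 / (1 - p))" using p by (simp add: ln_div)
    also have "\<dots> \<le> 1 / (1 - p) - 1" using p by (intro ln_le_minus_one) simp
    also have "\<dots> = p / (1 - p)" using p by (simp add: field_simps)
    finally have "- (p / (1 - p)) \<le> ln (1 - p)" by simp
    moreover have "0 \<le> (2 * ln (1 / p) + 4 * ln 2) * (\<bar>x\<bar> * indicator {y. 1/2 \<le> \<bar>y\<bar>} x)"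
      using K by (intro mult_nonneg_nonneg add_nonneg_nonneg) auto
    ultimately show ?thesis using True by (simp add: log_cell_def cell_weight_def)
  next
    case False
    let ?j = "\<bar>round x\<bar>"
    have j: "real (nat ?j) \<le> \<bar>x\<bar> + 1/2" "\<bar>x\<bar> \<ge> 1/2"
    proof -
      have "\<bar>of_int (round x) - x\<bar> \<le> 1/2" by (rule of_int_round_abs_le)
      moreover have "real (nat ?j) = \<bar>real_of_int (round x)\<bar>" by simp
      moreover have "\<bar>real_of_int (round x)\<bar> \<ge> 1" using False by linarith
      ultimately show "real (nat ?j) \<le> \<bar>x\<bar> + 1/2" "\<bar>x\<bar> \<ge> 1/2" by linarith+
    qed
    have "log_cell p x = - ln (1 / p) - (real (nat ?j) + 1) * ln 2"
      using False p unfolding log_cell_def cell_weight_def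
      by (simp add: ln_div ln_mult ln_realpow algebra_simps)
    moreover have "ln (1 / p) * 1 \<le> ln (1 / p) * (2 * \<bar>x\<bar>)" using K j by (intro mult_left_mono) auto
    moreover have "(real (nat ?j) + 1) * ln 2 \<le> (4 * \<bar>x\<bar>) * ln 2" using j by (intro mult_right_mono) auto
    moreover have "p / (1 - p) \<ge> 0" using p by simp
    ultimately show ?thesis using j by (simp add: algebra_simps)
  qed
qed

lemma linear_growth_log_cell:
  assumes p: "0 < p" "p < 1"
  shows "linear_growth (log_cell p)"
proof -
  let ?K = "2 * ln (1 / p) + 4 * ln 2"
  have K: "?K \<ge> 0" using p by simp
  have c: "p / (1 - p) \<ge> 0" using p by simp
  have "\<bar>log_cell p x\<bar> \<le> (p / (1 - p) + ?K) * (1 + \<bar>x\<bar>)" for x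
  proof -
    have "log_cell p x \<le> 0"
      using cell_weight_pos[OF p] cell_weight_le_1[OF p] by (simp add: log_cell_def)
    moreover have "?K * (\<bar>x\<bar> * indicator {y. 1/2 \<le> \<bar>y\<bar>} x) \<le> ?K * \<bar>x\<bar>"
      using K by (intro mult_left_mono) (auto simp: indicator_def)
    moreover have "p / (1 - p) + ?K * \<bar>x\<bar> \<le> (p / (1 - p) + ?K) * (1 + \<bar>x\<bar>)"
      
      using K mult_nonneg_nonneg[OF c abs_ge_zero[of x]] by (simp add: distrib_left distrib_right)
    ultimately show ?thesis using log_cell_lower[OF p, of x] by linarith
  qed
  moreover have "log_cell p \<in> borel_measurable borel"
  proof -
    have [measurable]: "(\<lambda>x::real. round x) \<in> measurable borel (count_space UNIV)"
      unfolding round_def by measurable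
    have [measurable]: "(\<lambda>j. ln (cell_weight p j)) \<in> measurable (count_space UNIV) borel" by simp
    show ?thesis unfolding log_cell_def by measurable
  qed
  ultimately show ?thesis unfolding linear_growth_def by blast
qed

text \<open>The hypothesis on \<open>p\<close> says that \<open>p/2\<close> bounds the mean of \<open>\<bar>s g\<bar>\<close> over the event \<open>\<bar>s g\<bar> \<ge> 1/2\<close>, for a standard
normal variable \<open>g\<close>. It makes \<open>p\<close> an upper bound for the probability of leaving the central cell.\<close>

lemma gaussian_average_log_cell:
  assumes p: "0 < p" "p < 1" and s: "s > 0"
    and tail: "2 * s * std_normal_density (1 / (2 * s)) \<le> p / 2"
  shows "gaussian_average (log_cell p) 0 s \<ge> - (p / (1 - p) + p * (ln (1 / p) + 2 * ln 2))"
proof -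
  let ?\<nu> = std_normal_distribution
  let ?K = "2 * ln (1 / p) + 4 * ln 2"
  let ?I = "\<lambda>g. \<bar>g\<bar> * indicator {x. 1 / (2 * s) \<le> \<bar>x\<bar>} g :: real"
  have K: "?K \<ge> 0" using p by simp
  have tm: "(\<integral>\<^sup>+g. ennreal (?I g) \<partial>?\<nu>) = ennreal (2 * std_normal_density (1 / (2 * s)))"
    using gaussian_tail_mean[of "1 / (2 * s)"] s by (simp add: ennreal_mult)
  then have hb: "has_bochner_integral ?\<nu> ?I (2 * std_normal_density (1 / (2 * s)))"
    by (intro has_bochner_integral_nn_integral) auto
  then have I: "integrable ?\<nu> ?I" "(LINT g|?\<nu>. ?I g) = 2 * std_normal_density (1 / (2 * s))"
    by (auto simp: has_bochner_integral_iff)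
  have int: "integrable ?\<nu> (\<lambda>g. log_cell p (0 + s * g))"
    using gaussian_average_semigroup(1)[OF linear_growth_log_cell[OF p], of 0 s 0] by (simp add: gaussian_average_0)
  have "- (p / (1 - p)) - ?K * s * ?I g \<le> log_cell p (0 + s * g)" for g
  proof -
    have "\<bar>s * g\<bar> * indicator {y. 1/2 \<le> \<bar>y\<bar>} (s * g) = s * ?I g"
      using s by (auto simp: indicator_def abs_mult field_simps)
    then show ?thesis using log_cell_lower[OF p, of "s * g"] by (simp add: mult.assoc)
  qed
  then have "(LINT g|?\<nu>. - (p / (1 - p)) - ?K * s * ?I g) \<le> gaussian_average (log_cell p) 0 s"
    unfolding gaussian_average_def using I int by (intro integral_mono) auto
  also have "(LINT g|?\<nu>. - (p / (1 - p)) - ?K * s * ?I g) = - (p / (1 - p)) - ?K * s * (LINT g|?\<nu>. ?I g)"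
    using I(1) std_normal.prob_space by simp
  finally have "- (p / (1 - p)) - ?K * (2 * s * std_normal_density (1 / (2 * s))) \<le> gaussian_average (log_cell p) 0 s"
    unfolding I(2) by (simp only: mult_ac)
  moreover have "?K * (2 * s * std_normal_density (1 / (2 * s))) \<le> ?K * (p / 2)"
    using K tail by (intro mult_left_mono)
  ultimately show ?thesis by (simp add: algebra_simps)
qed

lemma pi_ge_3: "pi \<ge> 3"
proof -
  have "sin (pi / 6) \<le> pi / 6" by (rule sin_x_le_x) simp
  then show ?thesis by (simp add: sin_30)
qed

text \<open>For the standard deviation \<open>\<sigma>/4\<close>, the boundary of the central cell is \<open>2/\<sigma>\<close> standard deviations away,
which explains the exponent \<open>- 2 / \<sigma>\<^sup>2\<close>; the factor \<open>41/100\<close> is an upper bound for \<open>1 / \<surd>(2 \<pi>)\<close>. The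
cost \<open>p ln (1/p)\<close> is of order \<open>exp (- 2 / \<sigma>\<^sup>2) / \<sigma>\<^sup>2\<close>, hence much smaller than \<open>\<sigma>\<^sup>2\<close> for small \<open>\<sigma>\<close>, and the
case \<open>\<sigma> = 1\<close> decides the constant. Among standard deviations \<open>\<rho> \<sigma>\<close> with different \<open>\<rho>\<close>, the value
\<open>\<rho> = 1/4\<close> leaves ample room between this cost and the gain in entropy.\<close>

lemma cell_cost:
  assumes \<sigma>: "0 < \<sigma>" "\<sigma> \<le> 1"
  defines "p \<equiv> 41/100 * exp (- 2 / \<sigma>\<^sup>2)"
  shows "0 < p" "p < 1" "gaussian_average (log_cell p) 0 (\<sigma> / 4) \<ge> - (\<sigma>\<^sup>2 / 3)"
proof -
  define u where "u = 1 / \<sigma>\<^sup>2"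
  have u: "u \<ge> 1" using \<sigma> by (simp add: u_def power_le_one)
  have pu: "p = 41/100 * exp (- 2 * u)" by (simp add: p_def u_def)
  define w where "w = u - 1"
  have w: "w \<ge> 0" "u = 1 + w" using u by (auto simp: w_def)
  have e2: "exp (2::real) \<ge> 7"
    using exp_ge_one_plus_x_over_n_power_n[of 40 "2::real"] by (simp add: power_divide)
  have ew: "exp (2 * w) \<ge> 1 + 2 * w + 2 * w\<^sup>2"
    using exp_lower_Taylor_quadratic[of "2 * w"] w by (simp add: power_mult_distrib)
  have eu: "exp (2 * u) \<ge> 7 * (1 + 2 * w + 2 * w\<^sup>2)"
  proof -
    have "7 * (1 + 2 * w + 2 * w\<^sup>2) \<le> exp 2 * exp (2 * w)"
      using e2 ew w by (intro mult_mono) auto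
    then show ?thesis by (simp add: w(2) exp_add[symmetric] distrib_left)
  qed
  show p0: "0 < p" by (simp add: p_def)
  have "exp (2 * u) \<ge> 7" using eu w by (smt (verit) zero_le_power2)
  then have p': "p \<le> 41/700" by (simp add: pu exp_minus field_simps)
  then show p1: "p < 1" by simp
  have ln2: "ln (2::real) \<le> 3/4"
  proof -
    have "(2::real) \<le> exp (3/4)"
      using exp_ge_one_plus_x_over_n_power_n[of 8 "3/4::real"] by (simp add: power_divide)
    then show ?thesis by (metis ln_exp ln_le_cancel_iff exp_gt_zero zero_less_numeral)
  qed
  have lnp: "ln (1 / p) \<le> 1 + 2 * u"
  proof -
    have "(100/41::real) \<le> exp 1"
      using exp_ge_one_plus_x_over_n_power_n[of 20 "1::real"] by (simp add: power_divide)
    then have "1 / p \<le> exp (1 + 2 * u)"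
      by (simp add: pu exp_minus exp_add field_simps)
    then show ?thesis using p0 by (metis ln_exp ln_le_cancel_iff exp_gt_zero zero_less_divide_1_iff)
  qed
  have tail: "2 * (\<sigma> / 4) * std_normal_density (1 / (2 * (\<sigma> / 4))) \<le> p / 2"
  proof -
    have "100/41 \<le> sqrt (2 * pi)"
      using pi_ge_3 by (intro real_le_rsqrt) (simp add: power2_eq_square)
    then have "1 / sqrt (2 * pi) \<le> 1 / (100/41)" by (intro divide_left_mono) auto
    then have sq: "1 / sqrt (2 * pi) \<le> 41/100" by simp
    have "std_normal_density (1 / (2 * (\<sigma> / 4))) = 1 / sqrt (2 * pi) * exp (- 2 * u)"
      by (simp add: std_normal_density_def u_def power_divide)
    also have "\<dots> \<le> p" unfolding pu using sq by (intro mult_right_mono) auto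
    finally have "std_normal_density (1 / (2 * (\<sigma> / 4))) \<le> p" .
    then have "2 * (\<sigma> / 4) * std_normal_density (1 / (2 * (\<sigma> / 4))) \<le> (1/2) * p"
      using \<sigma> by (intro mult_mono) auto
    then show ?thesis by simp
  qed
  have "p / (1 - p) \<le> p * (11/10)"
  proof -
    have "p / (1 - p) \<le> p / (10/11)" using p0 p' by (intro divide_left_mono) auto
    then show ?thesis by simp
  qed
  moreover have "p * (ln (1 / p) + 2 * ln 2) \<le> p * (5/2 + 2 * u)"
    using lnp ln2 p0 by (intro mult_left_mono) auto
  ultimately have "p / (1 - p) + p * (ln (1 / p) + 2 * ln 2) \<le> p * (18/5 + 2 * u)"
    unfolding distrib_left by linarith
  also have "\<dots> \<le> 1 / (3 * u)"
  proof -
    have "41/100 * (18/5 + 2 * u) * (3 * u) \<le> 7 * (1 + 2 * w + 2 * w\<^sup>2)"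
    proof -
      have "7 * (1 + 2 * w + 2 * w\<^sup>2) - 41/100 * (18/5 + 2 * u) * (3 * u)
          = 14/125 + 1163/250 * w + 577/50 * w\<^sup>2"
        by (simp add: w(2) power2_eq_square field_simps)
      also have "\<dots> \<ge> 0" using w by simp
      finally show ?thesis by simp
    qed
    also note eu
    finally show ?thesis using u by (simp add: pu exp_minus field_simps)
  qed
  also have "\<dots> = \<sigma>\<^sup>2 / 3" by (simp add: u_def)
  finally show "gaussian_average (log_cell p) 0 (\<sigma> / 4) \<ge> - (\<sigma>\<^sup>2 / 3)"
    using gaussian_average_log_cell[OF p0 p1 _ tail] \<sigma> by simp
qed

section \<open>A cell with many lattice points\<close>

text \<open>The Gaussian coordinates have standard deviation \<open>\<kappa>/4\<close>, so that the values, in units of \<open>\<kappa>\<close>, have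
standard deviation \<open>\<sigma>\<^sub>n/4\<close> as in \<open>cell_cost\<close>. The entropy per dimension is
\<open>1/2 + ln (\<pi>/4)/2 + ln (\<kappa>/\<surd>2) \<ge> 1/3 + ln (\<kappa>/\<surd>2)\<close>, and \<open>1/3\<close> per dimension is what the cells may cost in total.\<close>

lemma meixner_cell_count:
  fixes \<kappa> :: real and C :: ennreal
  assumes \<kappa>: "\<kappa> > 0" and N: "N > 0"
    and cells: "\<And>s \<beta>. emeasure (count_space (int_vectors 0 N)) {a \<in> int_vectors 0 N.
        \<forall>n<M. round (\<Sum>k<N. (of_int (a k) + s k) * (binom_profile k n / \<kappa>)) = \<beta> n} \<le> C"
  shows "ennreal ((\<kappa> / sqrt 2) ^ N) \<le> C"
proof -
  define \<sigma> where "\<sigma> n = sqrt (\<Sum>k<N. (meixner k n)\<^sup>2)" for n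
  define p where "p n = 41/100 * exp (- 2 / (\<sigma> n)\<^sup>2)" for n
  define h where "h = 1/2 + ln (2 * pi) / 2 + ln (\<kappa> / 4)"
  define f where "f k n = meixner k n / \<kappa>" for k n
  define B where "B k n = binom_profile k n / \<kappa>" for k n
  define Q where "Q v = ennreal (exp (\<Sum>n<M. log_cell (p n) (v n)))" for v :: "nat \<Rightarrow> real"
  have \<sigma>: "0 < \<sigma> n" "\<sigma> n \<le> 1" for n
  proof -
    have "0 < (meixner 0 n)\<^sup>2" using meixner_0 by simp
    also have "\<dots> \<le> (\<Sum>k<N. (meixner k n)\<^sup>2)" using N by (intro member_le_sum) auto
    finally show "0 < \<sigma> n" by (simp add: \<sigma>_def)
    show "\<sigma> n \<le> 1" using meixner_column_sum by (simp add: \<sigma>_def)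
  qed
  have p: "0 < p n" "p n < 1" and cost: "- ((\<sigma> n)\<^sup>2 / 3) \<le> gaussian_average (log_cell (p n)) 0 (\<sigma> n / 4)" for n
    using cell_cost[OF \<sigma>] by (simp_all add: p_def)
  have meas: "Q \<in> borel_measurable sequences"
  proof -
    have [measurable]: "log_cell (p n) \<in> borel_measurable borel" for n
      using linear_growth_log_cell[OF p] by (simp add: linear_growth_def)
    show ?thesis unfolding Q_def by measurable
  qed
  have h: "h \<ge> 1/3 + ln (\<kappa> / sqrt 2)"
  proof -
    have "ln (\<kappa> / 4) = ln (\<kappa> / sqrt 2 * (sqrt 2 / 4))" by simp
    also have "\<dots> = ln (\<kappa> / sqrt 2) + ln (sqrt 2 / 4)" using \<kappa> by (intro ln_mult_pos) auto
    finally have "ln (\<kappa> / 4) = ln (\<kappa> / sqrt 2) + ln (sqrt 2 / 4)" .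
    moreover have "ln (2 * pi) / 2 + ln (sqrt 2 / 4) = ln (pi / 4) / 2"
    proof -
      have "sqrt (2 * pi) * (sqrt 2 / 4) = sqrt (pi / 4)"
        by (simp add: real_sqrt_mult real_sqrt_divide)
      then have "ln (sqrt (2 * pi)) + ln (sqrt 2 / 4) = ln (sqrt (pi / 4))"
        by (subst ln_mult_pos[symmetric]) auto
      then show ?thesis by (simp add: ln_sqrt)
    qed
    moreover have "ln (pi / 4) \<ge> 1 - 4 / pi"
      using ln_le_minus_one[of "4 / pi"] by (simp add: ln_div)
    moreover have "4 / pi \<le> 4 / 3" using pi_ge_3 by (intro divide_left_mono) auto
    ultimately show ?thesis unfolding h_def by linarith
  qed
  \<comment> \<open>Only here do the row norms matter: they bound the total cost by the dimension.\<close>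
  have "(\<Sum>n<M. (\<sigma> n)\<^sup>2) = (\<Sum>k<N. \<Sum>n<M. (meixner k n)\<^sup>2)"
    by (subst sum.swap) (simp add: \<sigma>_def sum_nonneg)
  also have "\<dots> \<le> (\<Sum>k<N. 1)" by (intro sum_mono meixner_row_sum)
  finally have energy: "(\<Sum>n<M. (\<sigma> n)\<^sup>2) \<le> real N" by simp
  have "ennreal ((\<kappa> / sqrt 2) ^ N) = ennreal (exp (real N * ln (\<kappa> / sqrt 2)))"
    using \<kappa> by (simp add: exp_of_nat_mult)
  also have "\<dots> \<le> ennreal (exp ((\<Sum>n<M. gaussian_average (log_cell (p n)) 0 (\<kappa> / 4 * sqrt (\<Sum>k<N. (f k n)\<^sup>2))) + real N * h))"
  proof (intro ennreal_leI, subst exp_le_cancel_iff)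
    have "\<kappa> / 4 * sqrt (\<Sum>k<N. (f k n)\<^sup>2) = \<sigma> n / 4" for n
      using \<kappa> by (simp add: f_def \<sigma>_def power_divide sum_divide_distrib[symmetric] real_sqrt_divide)
    then have "(\<Sum>n<M. gaussian_average (log_cell (p n)) 0 (\<kappa> / 4 * sqrt (\<Sum>k<N. (f k n)\<^sup>2))) \<ge> (\<Sum>n<M. - ((\<sigma> n)\<^sup>2 / 3))"
      by (intro sum_mono) (simp add: cost)
    moreover have "(\<Sum>n<M. - ((\<sigma> n)\<^sup>2 / 3)) \<ge> - (real N / 3)"
      using energy by (simp add: sum_negf sum_divide_distrib[symmetric])
    moreover have "real N * h \<ge> real N * (1/3 + ln (\<kappa> / sqrt 2))" using h by (intro mult_left_mono) auto
    ultimately show "real N * ln (\<kappa> / sqrt 2)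
        \<le> (\<Sum>n<M. gaussian_average (log_cell (p n)) 0 (\<kappa> / 4 * sqrt (\<Sum>k<N. (f k n)\<^sup>2))) + real N * h"
      by (simp add: distrib_left)
  qed
  also have "\<dots> \<le> flat_integral f Q N (\<lambda>_. 0)"
    using gaussian_lower_bound[where l="\<lambda>n. log_cell (p n)" and v="\<lambda>_. 0" and r="\<kappa> / 4" and M=M and i=N and f=f]
      linear_growth_log_cell[OF p] \<kappa> by (simp add: h_def Q_def[abs_def])
  also have "\<dots> = flat_integral B Q N (\<lambda>_. 0)"
  proof -
    obtain c where c: "\<And>k n. meixner k n = binom_profile k n + (\<Sum>j<k. c k j * binom_profile j n)"
      using meixner_unitriangular by metis
    show ?thesis
      by (rule flat_integral_unitriangular[OF meas, where c=c])
         (simp add: f_def B_def c add_divide_distrib sum_divide_distrib)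
  qed
  also have "\<dots> \<le> C"
  proof (rule blichfeldt[OF meas])
    fix s
    let ?b = "\<lambda>n a. round (\<Sum>k<N. (of_int (a k) + s k) * B k n)"
    have "Q (\<lambda>n. \<Sum>k<N. (of_int (a k) + s k) * B k n) = (\<Prod>n<M. ennreal (cell_weight (p n) (?b n a)))" for a
      using cell_weight_pos[OF p]
      by (simp add: Q_def exp_sum log_cell_def prod_ennreal less_imp_le)
    then show "(\<integral>\<^sup>+a. Q (\<lambda>n. \<Sum>k<N. (of_int (a k) + s k) * B k n) \<partial>count_space (int_vectors 0 N)) \<le> C"
      using cell_count_bound[where S="int_vectors 0 N" and b="?b" and p=p and M=M and C=C] p cells
      by (simp add: B_def)
  qed
  finally show ?thesis .
qed

section \<open>Integer combinations of binomial coefficients\<close>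

lemma binomial_sum_determines_coefficients:
  fixes d :: "nat \<Rightarrow> real"
  assumes "\<And>n. n < N \<Longrightarrow> (\<Sum>k<N. d k * real (n choose k)) = 0" and "k < N"
  shows "d k = 0"
  using \<open>k < N\<close>
proof (induction k rule: less_induct)
  case (less k)
  have "(\<Sum>j<N. d j * real (k choose j)) = (\<Sum>j\<in>{k}. d j * real (k choose j))"
    using less by (intro sum.mono_neutral_right) (auto simp: neq_iff)
  with assms(1)[OF less.prems] show ?case by simp
qed

text \<open>The values at \<open>0, ..., k\<close> determine the \<open>k\<close>-th coefficient through a triangular system. The point is
that \<open>D\<close> depends only on the bounds \<open>b\<close>.\<close>

lemma binomial_sum_coefficient_bounds:
  fixes b :: "nat \<Rightarrow> real"
  assumes "m \<le> N"
  shows "\<exists>D. \<forall>d. (\<forall>n<N. \<bar>\<Sum>k<N. d k * real (n choose k)\<bar> \<le> b n) \<longrightarrow> (\<forall>k<m. \<bar>d k\<bar> \<le> D k)"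
  using assms
proof (induction m)
  case (Suc m)
  then obtain D where D: "\<And>d k. \<forall>n<N. \<bar>\<Sum>k<N. d k * real (n choose k)\<bar> \<le> b n \<Longrightarrow> k < m \<Longrightarrow> \<bar>d k\<bar> \<le> D k"
    by (metis Suc_leD)
  show ?case
  proof (intro exI allI impI)
    fix d k assume d: "\<forall>n<N. \<bar>\<Sum>k<N. d k * real (n choose k)\<bar> \<le> b n" and k: "k < Suc m"
    have "(\<Sum>j<N. d j * real (m choose j)) = (\<Sum>j<Suc m. d j * real (m choose j))"
      using Suc.prems by (intro sum.mono_neutral_right) auto
    then have "d m = (\<Sum>j<N. d j * real (m choose j)) - (\<Sum>j<m. d j * real (m choose j))" by simp
    moreover have "\<bar>\<Sum>j<N. d j * real (m choose j)\<bar> \<le> b m" using d Suc.prems by simp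
    moreover have "\<bar>\<Sum>j<m. d j * real (m choose j)\<bar> \<le> (\<Sum>j<m. D j * real (m choose j))"
      using D[OF d] by (intro order_trans[OF sum_abs] sum_mono) (auto simp: abs_mult intro!: mult_right_mono)
    ultimately have "\<bar>d m\<bar> \<le> b m + (\<Sum>j<m. D j * real (m choose j))" by linarith
    with D[OF d] k show "\<bar>d k\<bar> \<le> (D(m := b m + (\<Sum>j<m. D j * real (m choose j)))) k"
      by (auto simp: less_Suc_eq)
  qed
qed simp

text \<open>Bounds at the first \<open>N\<close> places bound all coefficients, hence give a fixed polynomial majorant, which
\<open>t \<phi>\<^sup>n\<close> eventually dominates. Thus \<open>M\<close> does not depend on the coefficients.\<close>

lemma binomial_sum_bound_extends:
  fixes t \<phi> :: real
  assumes "t > 0" "\<phi> > 1"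
  obtains M where "\<And>d n. (\<And>n. n < M \<Longrightarrow> \<bar>\<Sum>k<N. d k * real (n choose k)\<bar> \<le> t * \<phi> ^ n)
    \<Longrightarrow> \<bar>\<Sum>k<N. d k * real (n choose k)\<bar> \<le> t * \<phi> ^ n"
proof -
  obtain D where D: "\<And>d k. \<forall>n<N. \<bar>\<Sum>k<N. d k * real (n choose k)\<bar> \<le> t * \<phi> ^ n \<Longrightarrow> k < N \<Longrightarrow> \<bar>d k\<bar> \<le> D k"
    using binomial_sum_coefficient_bounds[of N N "\<lambda>n. t * \<phi> ^ n"] by (metis order_refl)
  have lim1: "(\<lambda>n. real (n choose k) / \<phi> ^ n) \<longlonglongrightarrow> 0" for k
  proof (rule Lim_null_comparison)
    show "(\<lambda>n. real n ^ k / \<phi> ^ n) \<longlonglongrightarrow> 0" using assms(2) by real_asymp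
    have "real (n choose k) \<le> real n ^ k" for n
    proof (cases "k \<le> n")
      case True
      from binomial_le_pow[OF this] have "real (n choose k) \<le> real (n ^ k)" by (rule of_nat_mono)
      then show ?thesis by simp
    qed (simp add: binomial_eq_0)
    then show "\<forall>\<^sub>F n in sequentially. norm (real (n choose k) / \<phi> ^ n) \<le> real n ^ k / \<phi> ^ n"
      using assms(2) by (intro always_eventually allI) (auto intro!: divide_right_mono)
  qed
  have "(\<lambda>n. \<Sum>k<N. D k * (real (n choose k) / \<phi> ^ n)) \<longlonglongrightarrow> (\<Sum>k<N. D k * 0)"
    by (intro tendsto_intros lim1)
  then have "\<forall>\<^sub>F n in sequentially. (\<Sum>k<N. D k * (real (n choose k) / \<phi> ^ n)) < t"
    using assms(1) by (intro order_tendstoD(2)) auto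
  then obtain M0 where M0: "\<And>n. n \<ge> M0 \<Longrightarrow> (\<Sum>k<N. D k * (real (n choose k) / \<phi> ^ n)) < t"
    by (auto simp: eventually_sequentially)
  show ?thesis
  proof (rule that[of "max M0 N"])
    fix d n assume small: "\<And>n. n < max M0 N \<Longrightarrow> \<bar>\<Sum>k<N. d k * real (n choose k)\<bar> \<le> t * \<phi> ^ n"
    show "\<bar>\<Sum>k<N. d k * real (n choose k)\<bar> \<le> t * \<phi> ^ n"
    proof (cases "n < max M0 N")
      case False
      have "\<bar>\<Sum>k<N. d k * real (n choose k)\<bar> \<le> (\<Sum>k<N. D k * real (n choose k))"
        using D[of d] small by (intro order_trans[OF sum_abs] sum_mono) (auto simp: abs_mult intro!: mult_right_mono)
      also have "\<dots> = (\<Sum>k<N. D k * (real (n choose k) / \<phi> ^ n)) * \<phi> ^ n"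
        using assms(2) by (simp add: sum_distrib_right)
      also have "\<dots> \<le> t * \<phi> ^ n" using False assms(2) by (intro mult_right_mono less_imp_le[OF M0]) auto
      finally show ?thesis .
    qed (use small in blast)
  qed
qed

definition binomial_poly :: "nat \<Rightarrow> real poly" where
  "binomial_poly k = smult (1 / fact k) (\<Prod>i<k. [:- of_nat i, 1:])"

lemma poly_binomial_poly: "poly (binomial_poly k) (real n) = real (n choose k)"
  by (simp add: binomial_poly_def poly_prod binomial_gbinomial gbinomial_prod_rev atLeast0LessThan)

theorem theorem1p1:
  fixes \<epsilon> :: real
  assumes "\<epsilon> > 0"
  shows "infinite {P :: real poly. integer_valued P \<and>
    (\<forall>n::nat. \<bar>poly P (real n)\<bar> \<le> (sqrt (2 * golden_ratio) + \<epsilon>) * golden_ratio ^ n)}"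
    (is "infinite ?G")
proof
  assume fin: "finite ?G"
  define t where "t = sqrt (2 * golden_ratio) + \<epsilon>"
  define \<kappa> where "\<kappa> = t / sqrt golden_ratio"
  have g: "golden_ratio > 1" "golden_ratio > 0" using golden_ratio_gt_1 by auto
  have t: "t > 0" using assms g by (simp add: t_def add_nonneg_pos)
  have \<kappa>: "\<kappa> > 0" "\<kappa> / sqrt 2 > 1"
  proof -
    show "\<kappa> > 0" using t g by (simp add: \<kappa>_def)
    have "sqrt 2 * sqrt golden_ratio < t" using assms by (simp add: t_def real_sqrt_mult)
    then show "\<kappa> / sqrt 2 > 1" using g by (simp add: \<kappa>_def field_simps)
  qed
  obtain N where N: "N > 0" "real (card ?G) < (\<kappa> / sqrt 2) ^ N"
  proof -
    obtain N0 where "real (card ?G) < (\<kappa> / sqrt 2) ^ N0" using real_arch_pow[OF \<kappa>(2)] by blast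
    also have "\<dots> \<le> (\<kappa> / sqrt 2) ^ Suc N0" using \<kappa>(2) by (intro power_increasing) auto
    finally show ?thesis using that[of "Suc N0"] by simp
  qed
  obtain M where M: "\<And>d n. (\<And>n. n < M \<Longrightarrow> \<bar>\<Sum>k<N. d k * real (n choose k)\<bar> \<le> t * golden_ratio ^ n)
    \<Longrightarrow> \<bar>\<Sum>k<N. d k * real (n choose k)\<bar> \<le> t * golden_ratio ^ n"
    using binomial_sum_bound_extends[OF t g(1)] by blast
  have "ennreal ((\<kappa> / sqrt 2) ^ N) \<le> of_nat (card ?G)"
  proof (rule meixner_cell_count[OF \<kappa>(1) N(1)])
    fix s :: "nat \<Rightarrow> real" and \<beta>
    let ?v = "\<lambda>a n. \<Sum>k<N. (real_of_int (a k) + s k) * (binom_profile k n / \<kappa>)"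
    define S where "S = {a \<in> int_vectors 0 N. \<forall>n<M. round (?v a n) = \<beta> n}"
    show "emeasure (count_space (int_vectors 0 N)) S \<le> of_nat (card ?G)"
    proof (cases "S = {}")
      case False
      then obtain a0 where a0: "a0 \<in> S" by blast
      \<comment> \<open>Subtracting a fixed point of the cell removes the shift \<open>s\<close> and leaves an integer-valued polynomial.\<close>
      define P where "P a = (\<Sum>k<N. smult (of_int (a k - a0 k)) (binomial_poly k))" for a
      have P: "poly (P a) (real n) = (\<Sum>k<N. of_int (a k - a0 k) * real (n choose k))" for a n
        by (simp add: P_def poly_sum poly_binomial_poly)
      have in_G: "P a \<in> ?G" if "a \<in> S" for a
      proof -
        have "\<bar>\<Sum>k<N. of_int (a k - a0 k) * real (n choose k)\<bar> \<le> t * golden_ratio ^ n" if "n < M" for n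
        proof -
          have "round (?v a n) = round (?v a0 n)" using \<open>a \<in> S\<close> a0 that by (simp add: S_def)
          then have "\<bar>?v a n - ?v a0 n\<bar> \<le> 1" by (rule round_eq_imp_close)
          also have "?v a n - ?v a0 n
              = (\<Sum>k<N. of_int (a k - a0 k) * real (n choose k)) / (t * golden_ratio ^ n)"
          proof -
            have "binom_profile k n / \<kappa> = real (n choose k) / (t * golden_ratio ^ n)" for k
              using g by (simp add: binom_profile_def \<kappa>_def)
            then show ?thesis
              by (simp add: sum_subtractf[symmetric] sum_divide_distrib left_diff_distrib[symmetric] diff_divide_distrib[symmetric])
          qed
          finally show ?thesis using g t by (simp add: abs_divide abs_mult)
        qed
        then have "\<bar>poly (P a) (real n)\<bar> \<le> t * golden_ratio ^ n" for n
          unfolding P by (rule M)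
        moreover have "integer_valued (P a)"
        proof -
          have "poly (P a) (real n) = of_int (\<Sum>k<N. (a k - a0 k) * int (n choose k))" for n
            by (simp add: P)
          then show ?thesis unfolding integer_valued_def by (metis Ints_of_int)
        qed
        ultimately show ?thesis by (simp add: t_def)
      qed
      have inj: "inj_on P S"
      proof (rule inj_onI, rule ext)
        fix a a' k assume *: "a \<in> S" "a' \<in> S" "P a = P a'"
        show "a k = a' k"
        proof (cases "k < N")
          case True
          have "(\<Sum>k<N. of_int (a k - a' k) * real (n choose k)) = 0" for n
            using arg_cong[OF *(3), of "\<lambda>p. poly p (real n)"]
            by (simp add: P sum_subtractf left_diff_distrib)
          from binomial_sum_determines_coefficients[OF this True] show ?thesis by simp
        next
          case False
          then show ?thesis using *(1,2) by (force simp: S_def int_vectors_def)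
        qed
      qed
      have sub: "P ` S \<subseteq> ?G" using in_G by (rule image_subsetI)
      have "finite S" "card S \<le> card ?G"
        using inj_on_finite[OF inj sub fin] card_inj_on_le[OF inj sub fin] by simp_all
      then show ?thesis by (subst emeasure_count_space_finite) (auto simp: S_def)
    qed simp
  qed
  then have "(\<kappa> / sqrt 2) ^ N \<le> real (card ?G)"
    by (simp add: ennreal_of_nat_eq_real_of_nat)
  with N(2) show False by simp
qed

end
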